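(* Let $\lambda,\mu,H>0$ with $\lambda\neq\mu$. The probability $P_{0,H}$ that the particle starting from the origin hits the level $H$ before hitting the origin again, and the probability $P_{H,0}$ that the particle starting from the level $H$ hits the origin before hitting $H$ again, are $$P_{0,H}=\frac{\mu-\lambda}{\mu-\lambda e^{(\lambda-\mu)H}},\qquad P_{H,0}=\frac{\lambda-\mu}{\lambda-\mu e^{(\mu-\lambda)H}}.$$ The probability $P_{0,0}$ that the particle starting from the origin hits the origin again before hitting $H$, and the probability $P_{H,H}$ that the particle starting from $H$ hits $H$ again before hitting the origin, are $$P_{0,0}=1-P_{0,H}=\frac{\lambda e^{H(\lambda-\mu)}-\lambda}{\lambda e^{H(\lambda-\mu)}-\mu},\qquad P_{H,H}=1-P_{H,0}=\frac{\mu\left(1-e^{-(\lambda-\mu)H}\right)}{\lambda-\mu e^{-(\lambda-\mu)H}}.$$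
   Context: Setting. A particle moves on $[0,H]$ with unit speed, alternately upward for i.i.d. $\mathrm{Exp}(\lambda)$ times $U_1,U_2,\dots$ and downward for i.i.d. $\mathrm{Exp}(\mu)$ times $D_1,D_2,\dots$ (rates $\lambda,\mu>0$; all times independent). A particle starting at $0$ first moves up; a particle starting at $H$ first moves down, for an $\mathrm{Exp}(\mu)$ time $D$ independent of the other variables. Let $N(t)=\max\{n\ge 0:\sum_{i=1}^n U_i\le t\}$ (Poisson process of intensity $\lambda$) and $Y(t)=\sum_{n=1}^{N(t)}D_n$, $t\ge0$ (compound Poisson process, empty sum $=0$). Here $t$ is the accumulated upward time and $Y(t)$ the accumulated downward time. With $\inf\emptyset=+\infty$, put $$T_{0,0}=\inf\{t>0:Y(t)\ge t\},\quad T_{0,H}=\inf\{t\ge H:Y(t)=t-H\},\quad T_0^*=\min\{T_{0,0},T_{0,H}\},$$ $$T_{H,H}(D)=\inf\{t\ge0:Y(t)=t-D\},\quad T_{H,0}(D)=\inf\{t\ge0:Y(t)\ge t-D+H\},\quad T_H^*(D)=\min\{T_{H,H}(D),T_{H,0}(D)\}.$$ The probabilities in question are $P_{0,0}=\mathbb P(T_0^*=T_{0,0})$, $P_{0,H}=\mathbb P(T_0^*=T_{0,H})$, $P_{H,H}=\mathbb P(T_H^*(D)=T_{H,H}(D))$, $P_{H,0}=\mathbb P(T_H^*(D)=T_{H,0}(D))$, where in the last two $D\sim\mathrm{Exp}(\mu)$ is independent of $Y$. *)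

theory Defs
  imports "HOL-Probability.Probability"
begin

text \<open>
  The sequences \<open>U\<close> and \<open>D\<close> are used at indices \<open>n \<ge> 1\<close> only. For \<open>t \<ge> 0\<close> the set below contains
  \<open>0\<close>; almost surely it is finite, and on the exceptional null set \<open>Max\<close> is an unspecified constant.
\<close>

definition upcount :: "(nat \<Rightarrow> 'a \<Rightarrow> real) \<Rightarrow> real \<Rightarrow> 'a \<Rightarrow> nat" where
  "upcount U t \<omega> = Max {n. (\<Sum>i=1..n. U i \<omega>) \<le> t}"

definition downtime :: "(nat \<Rightarrow> 'a \<Rightarrow> real) \<Rightarrow> (nat \<Rightarrow> 'a \<Rightarrow> real) \<Rightarrow> real \<Rightarrow> 'a \<Rightarrow> real" where
  "downtime U D t \<omega> = (\<Sum>n=1..upcount U t \<omega>. D n \<omega>)"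

text \<open>
  Hitting times, measured in accumulated upward time, are extended reals, so that
  \<open>Inf {} = \<infinity>\<close>. The argument \<open>d\<close> is the length of the initial downward
  movement of a particle starting at \<open>H\<close>.
\<close>

definition T_00 :: "(nat \<Rightarrow> 'a \<Rightarrow> real) \<Rightarrow> (nat \<Rightarrow> 'a \<Rightarrow> real) \<Rightarrow> 'a \<Rightarrow> ereal" where
  "T_00 U D \<omega> = Inf (ereal ` {t. 0 < t \<and> downtime U D t \<omega> \<ge> t})"

definition T_0H :: "real \<Rightarrow> (nat \<Rightarrow> 'a \<Rightarrow> real) \<Rightarrow> (nat \<Rightarrow> 'a \<Rightarrow> real) \<Rightarrow> 'a \<Rightarrow> ereal" where
  "T_0H H U D \<omega> = Inf (ereal ` {t. H \<le> t \<and> downtime U D t \<omega> = t - H})"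

definition T_0_star :: "real \<Rightarrow> (nat \<Rightarrow> 'a \<Rightarrow> real) \<Rightarrow> (nat \<Rightarrow> 'a \<Rightarrow> real) \<Rightarrow> 'a \<Rightarrow> ereal" where
  "T_0_star H U D \<omega> = min (T_00 U D \<omega>) (T_0H H U D \<omega>)"

definition T_HH :: "(nat \<Rightarrow> 'a \<Rightarrow> real) \<Rightarrow> (nat \<Rightarrow> 'a \<Rightarrow> real) \<Rightarrow> real \<Rightarrow> 'a \<Rightarrow> ereal" where
  "T_HH U D d \<omega> = Inf (ereal ` {t. 0 \<le> t \<and> downtime U D t \<omega> = t - d})"

definition T_H0 :: "real \<Rightarrow> (nat \<Rightarrow> 'a \<Rightarrow> real) \<Rightarrow> (nat \<Rightarrow> 'a \<Rightarrow> real) \<Rightarrow> real \<Rightarrow> 'a \<Rightarrow> ereal" where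
  "T_H0 H U D d \<omega> = Inf (ereal ` {t. 0 \<le> t \<and> downtime U D t \<omega> \<ge> t - d + H})"

definition T_H_star :: "real \<Rightarrow> (nat \<Rightarrow> 'a \<Rightarrow> real) \<Rightarrow> (nat \<Rightarrow> 'a \<Rightarrow> real) \<Rightarrow> real \<Rightarrow> 'a \<Rightarrow> ereal" where
  "T_H_star H U D d \<omega> = min (T_HH U D d \<omega>) (T_H0 H U D d \<omega>)"

definition P_00 :: "'a measure \<Rightarrow> real \<Rightarrow> (nat \<Rightarrow> 'a \<Rightarrow> real) \<Rightarrow> (nat \<Rightarrow> 'a \<Rightarrow> real) \<Rightarrow> real" where
  "P_00 M H U D = measure M {\<omega> \<in> space M. T_0_star H U D \<omega> = T_00 U D \<omega>}"

definition P_0H :: "'a measure \<Rightarrow> real \<Rightarrow> (nat \<Rightarrow> 'a \<Rightarrow> real) \<Rightarrow> (nat \<Rightarrow> 'a \<Rightarrow> real) \<Rightarrow> real" where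
  "P_0H M H U D = measure M {\<omega> \<in> space M. T_0_star H U D \<omega> = T_0H H U D \<omega>}"

definition P_HH ::
  "'a measure \<Rightarrow> real \<Rightarrow> (nat \<Rightarrow> 'a \<Rightarrow> real) \<Rightarrow> (nat \<Rightarrow> 'a \<Rightarrow> real) \<Rightarrow> ('a \<Rightarrow> real) \<Rightarrow> real" where
  "P_HH M H U D D0 = measure M {\<omega> \<in> space M. T_H_star H U D (D0 \<omega>) \<omega> = T_HH U D (D0 \<omega>) \<omega>}"

definition P_H0 ::
  "'a measure \<Rightarrow> real \<Rightarrow> (nat \<Rightarrow> 'a \<Rightarrow> real) \<Rightarrow> (nat \<Rightarrow> 'a \<Rightarrow> real) \<Rightarrow> ('a \<Rightarrow> real) \<Rightarrow> real" where
  "P_H0 M H U D D0 = measure M {\<omega> \<in> space M. T_H_star H U D (D0 \<omega>) \<omega> = T_H0 H U D (D0 \<omega>) \<omega>}"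

end

theory Submission
  imports Defs
begin

text \<open>
  The particle is observed at its turning points only. Reflecting the interval after every move makes
  all moves upward: from \<open>q\<close>, an exponential move \<open>X\<close> (the rates alternate) either leaves \<open>[0, H]\<close>
  or leads to \<open>H - (q + X)\<close>, and the particle reaches the opposite side before its starting side
  exactly when the index of the first exit is even. By memorylessness, with \<open>r\<close> the current and
  \<open>s\<close> the next rate, \<open>\<alpha> + \<beta> exp ((r - s) q)\<close> is a martingale whose value on exit does not depend on
  the overshoot; \<open>\<alpha>\<close> and \<open>\<beta>\<close> are free, so optional stopping gives two linear equations for the
  probabilities of an even and of an odd exit. The probability of surviving \<open>n\<close> moves decays
  geometrically.
\<close>

section \<open>The reflected walk\<close>

text \<open>By injectivity an intersection over \<open>J\<close> is one over its image under
  \<open>f\<close>, each set being taken once. This is what allows the up and down times to be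
  listed as one alternating sequence.\<close>

lemma (in prob_space) indep_sets_reindex:
  assumes "indep_sets F (f ` I)" "inj_on f I"
  shows "indep_sets (\<lambda>i. F (f i)) I"
  unfolding indep_sets_def
proof (intro conjI ballI allI impI)
  fix i assume "i \<in> I" then show "F (f i) \<subseteq> events"
    using assms by (auto simp: indep_sets_def)
next
  fix J A assume J: "J \<subseteq> I" "J \<noteq> {}" "finite J" and A: "A \<in> Pi J (\<lambda>i. F (f i))"
  let ?g = "the_inv_into J f"
  have inj: "inj_on f J" using J assms inj_on_subset by blast
  have "prob (\<Inter>k\<in>f ` J. A (?g k)) = (\<Prod>k\<in>f ` J. prob (A (?g k)))"
    using A J inj
    by (intro indep_setsD[OF assms(1)]) (auto simp: the_inv_into_f_f Pi_iff)
  then show "prob (\<Inter>j\<in>J. A j) = (\<Prod>j\<in>J. prob (A j))"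
    using inj by (simp add: prod.reindex the_inv_into_f_f)
qed

lemma (in prob_space) indep_vars_reindex:
  assumes "indep_vars M' X (f ` I)" "inj_on f I"
  shows "indep_vars (\<lambda>i. M' (f i)) (\<lambda>i. X (f i)) I"
  using assms indep_sets_reindex[of "\<lambda>i. {X i -` A \<inter> space M | A. A \<in> sets (M' i)}" f I]
  by (auto simp: indep_vars_def2)

text \<open>
  Turning points of the reflected motion started at \<open>z\<close>, with the value \<open>-1\<close> once the walk has left
  \<open>[0, H]\<close>. The case \<open>x n < 0\<close> has probability zero; killing the walk there keeps it bounded by \<open>H\<close> on
  every path. Exits are strict: the boundary case \<open>walk H z x n + x n = H\<close> is null.
\<close>

fun walk :: "real \<Rightarrow> real \<Rightarrow> (nat \<Rightarrow> real) \<Rightarrow> nat \<Rightarrow> real" where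
  "walk H z x 0 = z"
| "walk H z x (Suc n) =
    (if 0 \<le> walk H z x n \<and> 0 \<le> x n \<and> walk H z x n + x n < H then H - (walk H z x n + x n) else -1)"

definition exits :: "real \<Rightarrow> real \<Rightarrow> (nat \<Rightarrow> real) \<Rightarrow> nat \<Rightarrow> bool" where
  "exits H z x n \<longleftrightarrow> 0 \<le> walk H z x n \<and> H < walk H z x n + x n"

lemma walk_cong: "(\<And>k. k < n \<Longrightarrow> x k = y k) \<Longrightarrow> walk H z x n = walk H z y n"
  by (induction n) auto

lemma walk_le: "z \<le> H \<Longrightarrow> 0 \<le> H \<Longrightarrow> walk H z x n \<le> H"
  by (cases n) auto

text \<open>Serves the particle starting at \<open>H\<close>: its initial descent is the first
  reflected move, after which the walk restarts from a general point.\<close>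

lemma walk_shift:
  "0 \<le> z \<Longrightarrow> 0 \<le> x 0 \<Longrightarrow> z + x 0 < H \<Longrightarrow> walk H z x (Suc n) = walk H (H - (z + x 0)) (\<lambda>k. x (Suc k)) n"
  by (induction n) auto

lemma walk_alive_antimono: "0 \<le> walk H z x n \<Longrightarrow> m \<le> n \<Longrightarrow> 0 \<le> walk H z x m"
  by (induction n) (auto simp: le_Suc_eq split: if_splits)

text \<open>Death is permanent, so being alive at \<open>n\<close> forces every earlier move into
  the reflecting branch of \<open>walk\<close>; up to an exit the recursion thus loses its case
  distinction.\<close>

lemma exits_before:
  assumes "exits H z x n" "k < n"
  shows "0 \<le> walk H z x k" "walk H z x k + x k < H" "walk H z x (Suc k) = H - (walk H z x k + x k)" "0 \<le> x k"
proof -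
  have "0 \<le> walk H z x (Suc k)"
    using assms walk_alive_antimono[of H z x n "Suc k"] by (auto simp: exits_def)
  then show "0 \<le> walk H z x k" "walk H z x k + x k < H"
      "walk H z x (Suc k) = H - (walk H z x k + x k)" "0 \<le> x k"
    by (auto split: if_splits)
qed

lemma exits_unique: "exits H z x m \<Longrightarrow> exits H z x n \<Longrightarrow> m = n"
  using exits_before(2)[of H z x m n] exits_before(2)[of H z x n m]
  by (cases m n rule: linorder_cases) (auto simp: exits_def)

text \<open>Only the coordinates below \<open>n\<close> are asked to be measurable, because the
  lemma is also applied on the product space over \<open>{..<n}\<close>.\<close>

lemma measurable_walk [measurable (raw)]:
  assumes "\<And>k. k < n \<Longrightarrow> (\<lambda>\<omega>. X \<omega> k) \<in> borel_measurable M"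
  shows "(\<lambda>\<omega>. walk H z (X \<omega>) n) \<in> borel_measurable M"
  using assms
proof (induction n)
  case (Suc n)
  have [measurable]: "(\<lambda>\<omega>. X \<omega> n) \<in> borel_measurable M" "(\<lambda>\<omega>. walk H z (X \<omega>) n) \<in> borel_measurable M"
    using Suc by auto
  show ?case by simp
qed simp

text \<open>The position at time \<open>n\<close> is a function of the moves before
  \<open>n\<close>, which are independent of move \<open>n\<close>.\<close>

lemma (in prob_space) indep_walk:
  assumes ind: "indep_vars (\<lambda>_. borel) X UNIV"
  shows "indep_var borel (\<lambda>\<omega>. walk H z (\<lambda>k. X k \<omega>) n) borel (X n)"
proof -
  let ?P = "\<lambda>I. Pi\<^sub>M I (\<lambda>_. borel :: real measure)"
  have "indep_var borel ((\<lambda>x. walk H z x n) \<circ> (\<lambda>\<omega>. \<lambda>k\<in>{..<n}. X k \<omega>))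
      borel ((\<lambda>x. x n) \<circ> (\<lambda>\<omega>. \<lambda>k\<in>{n}. X k \<omega>))"
  proof (rule indep_var_compose[OF indep_var_restrict[OF ind]])
    show "(\<lambda>x. walk H z x n) \<in> ?P {..<n} \<rightarrow>\<^sub>M borel"
      by (rule measurable_walk) (auto intro!: measurable_component_singleton)
  qed auto
  moreover have "(\<lambda>x. walk H z x n) \<circ> (\<lambda>\<omega>. \<lambda>k\<in>{..<n}. X k \<omega>) = (\<lambda>\<omega>. walk H z (\<lambda>k. X k \<omega>) n)"
    by (auto simp: fun_eq_iff intro!: walk_cong)
  moreover have "(\<lambda>x. x n) \<circ> (\<lambda>\<omega>. \<lambda>k\<in>{n}. X k \<omega>) = X n"
    by (auto simp: fun_eq_iff)
  ultimately show ?thesis by simp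
qed

section \<open>Exit probabilities\<close>

text \<open>Stands in for conditioning on \<open>X\<close>: the joint law is the product of the
  marginals, and Fubini applies since \<open>f\<close> is bounded.\<close>

lemma (in prob_space) expectation_indep_pair:
  fixes f :: "real \<Rightarrow> real \<Rightarrow> real"
  assumes ind: "indep_var borel X borel Y"
    and f[measurable]: "case_prod f \<in> borel_measurable (borel \<Otimes>\<^sub>M borel)"
    and bnd: "\<And>x y. \<bar>f x y\<bar> \<le> B"
  shows "expectation (\<lambda>\<omega>. f (X \<omega>) (Y \<omega>)) = expectation (\<lambda>\<omega>. expectation (\<lambda>\<omega>'. f (X \<omega>) (Y \<omega>')))"
proof -
  have [measurable]: "random_variable borel X" "random_variable borel Y"
    using indep_var_rv1[OF ind] indep_var_rv2[OF ind] by auto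
  interpret X: prob_space "distr M borel X" by (rule prob_space_distr) measurable
  interpret Y: prob_space "distr M borel Y" by (rule prob_space_distr) measurable
  interpret XY: pair_prob_space "distr M borel X" "distr M borel Y" ..
  have int: "integrable (distr M borel X \<Otimes>\<^sub>M distr M borel Y) (case_prod f)"
    by (rule XY.P.integrable_const_bound[where B = B]) (auto simp: bnd)
  have "expectation (\<lambda>\<omega>. f (X \<omega>) (Y \<omega>))
      = integral\<^sup>L (distr M (borel \<Otimes>\<^sub>M borel) (\<lambda>\<omega>. (X \<omega>, Y \<omega>))) (case_prod f)"
    by (subst integral_distr) auto
  also have "\<dots> = integral\<^sup>L (distr M borel X \<Otimes>\<^sub>M distr M borel Y) (case_prod f)"
    using ind by (simp add: indep_var_distribution_eq)
  also have "\<dots> = (LINT x|distr M borel X. LINT y|distr M borel Y. f x y)"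
    using XY.integral_fst'[OF int] by simp
  also have "\<dots> = expectation (\<lambda>\<omega>. LINT y|distr M borel Y. f (X \<omega>) y)"
    by (subst integral_distr) auto
  also have "\<dots> = expectation (\<lambda>\<omega>. expectation (\<lambda>\<omega>'. f (X \<omega>) (Y \<omega>')))"
    by (subst integral_distr) auto
  finally show ?thesis .
qed

section \<open>The one-step martingale identity\<close>

text \<open>The weight \<open>(s / r) * exp ((r - s) * x)\<close> tilts the density of rate
  \<open>r\<close> into that of rate \<open>s\<close>, so the exponential part of the surviving
  payoff integrates to \<open>\<beta> * exp ((r - s) * q)\<close> times
  \<open>1 - exp (- s * (H - q))\<close>. The missing part is supplied by the exit, of probability
  \<open>exp (- r * (H - q))\<close>, whose payoff is frozen at the level \<open>H\<close>.\<close>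

lemma (in prob_space) expectation_exponential_step:
  fixes X :: "'a \<Rightarrow> real" and r s q H \<alpha> \<beta> :: real
  assumes X: "distributed M lborel X (exponential_density r)"
    and r: "0 < r" and s: "0 < s" and q: "q \<le> H"
  shows "expectation (\<lambda>\<omega>. if H < q + X \<omega> then \<alpha> + \<beta> * exp ((r - s) * H)
            else if 0 \<le> X \<omega> \<and> q + X \<omega> < H then \<alpha> + \<beta> * (s / r) * exp ((r - s) * (q + X \<omega>)) else 0)
          = \<alpha> + \<beta> * exp ((r - s) * q)"
proof -
  let ?c = "\<alpha> + \<beta> * exp ((r - s) * H)"
  let ?g = "\<lambda>x. \<alpha> + \<beta> * (s / r) * exp ((r - s) * (q + x))"
  let ?a = "H - q"
  \<comment> \<open>An antiderivative of the density times \<open>?g\<close>, after the exponentials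
    have merged into \<open>exp ((r - s) * q) * exp (- (s * x))\<close>.\<close>
  let ?F = "\<lambda>x. - \<alpha> * exp (- (r * x)) - \<beta> * exp ((r - s) * q) * exp (- (s * x))"
  have [measurable]: "X \<in> borel_measurable M"
    using distributed_measurable[OF X] by simp
  have dens: "expectation (\<lambda>\<omega>. h (X \<omega>)) = (LINT x|lborel. exponential_density r x * h x)"
    if "h \<in> borel_measurable borel" for h :: "real \<Rightarrow> real"
    using distributed_integral[OF X, of h] that r by (simp add: exponential_density_nonneg)
  let ?tail = "\<lambda>x. ?c * indicator {?a<..} x"
  let ?body = "\<lambda>x. indicator {0..?a} x * ?g x"
  have tail: "expectation (\<lambda>\<omega>. ?tail (X \<omega>)) = ?c * exp (- (r * ?a))"
  proof -
    have "expectation (\<lambda>\<omega>. indicator {?a<..} (X \<omega>)) = expectation (indicator {\<omega> \<in> space M. ?a < X \<omega>})"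
      by (rule Bochner_Integration.integral_cong) (auto simp: indicator_def)
    also have "\<dots> = exp (- (r * ?a))"
      using exponential_distributedD_gt[OF X, of ?a] q r by (simp add: algebra_simps)
    finally show ?thesis by simp
  qed
  have hb: "has_bochner_integral lborel (\<lambda>x. r * exp (- (r * x)) * ?g x * indicator {0..?a} x) (?F ?a - ?F 0)"
  proof (rule has_bochner_integral_FTC_Icc_real)
    show "0 \<le> ?a" using q by simp
    show "(?F has_real_derivative r * exp (- (r * x)) * ?g x) (at x)" if "0 \<le> x" "x \<le> ?a" for x
    proof -
      have "exp ((r - s) * q) * exp (- (s * x)) = exp (- (r * x)) * exp ((r - s) * (q + x))"
        by (simp add: exp_add[symmetric] algebra_simps)
      then show ?thesis using r
        by (auto intro!: derivative_eq_intros simp: field_simps)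
    qed
  qed (use r in \<open>auto intro!: continuous_intros\<close>)
  have eq: "(\<lambda>x. r * exp (- (r * x)) * ?g x * indicator {0..?a} x)
      = (\<lambda>x. exponential_density r x * ?body x)"
    by (auto simp: fun_eq_iff exponential_density_def indicator_def mult.commute[of r])
  have body: "expectation (\<lambda>\<omega>. ?body (X \<omega>)) = ?F ?a - ?F 0"
    using hb unfolding eq by (subst dens) (auto simp: has_bochner_integral_iff)
  have "integrable lborel (\<lambda>x. exponential_density r x * ?body x)"
    using hb unfolding eq by (simp add: has_bochner_integral_iff)
  then have ibody: "integrable M (\<lambda>\<omega>. ?body (X \<omega>))"
    using distributed_integrable[OF X, of ?body] r by (simp add: exponential_density_nonneg)
  have itail: "integrable M (\<lambda>\<omega>. ?tail (X \<omega>))"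
    by (rule integrable_const_bound[where B = "\<bar>?c\<bar>"]) (auto simp: indicator_def)
  \<comment> \<open>The payoff and the sum of \<open>?tail\<close> and \<open>?body\<close> differ
    at most where \<open>X\<close> equals \<open>H - q\<close>, a null event.\<close>
  have "AE x in lborel. x \<noteq> ?a" by (rule AE_lborel_singleton)
  then have "AE \<omega> in M. 0 \<le> X \<omega> \<and> X \<omega> \<noteq> ?a"
    using distributed_AE2[OF X, of "\<lambda>x. 0 \<le> x \<and> x \<noteq> ?a"]
    by (auto simp: exponential_density_def elim!: eventually_mono)
  then have "expectation (\<lambda>\<omega>. if H < q + X \<omega> then ?c else if 0 \<le> X \<omega> \<and> q + X \<omega> < H then ?g (X \<omega>) else 0)
      = expectation (\<lambda>\<omega>. ?tail (X \<omega>) + ?body (X \<omega>))"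
    by (intro integral_cong_AE) (measurable, auto simp: indicator_def)
  also have "\<dots> = ?c * exp (- (r * ?a)) + (?F ?a - ?F 0)"
    unfolding tail[symmetric] body[symmetric]
    using ibody by (intro Bochner_Integration.integral_add itail)
  also have "\<dots> = \<alpha> + \<beta> * exp ((r - s) * q)"
  proof -
    have "exp ((r - s) * H) * exp (- (r * ?a)) = exp ((r - s) * q) * exp (- (s * ?a))"
      by (simp add: exp_add[symmetric] algebra_simps)
    then show ?thesis by (simp add: algebra_simps)
  qed
  finally show ?thesis .
qed

text \<open>Averages the one-step identity over the walk. In terms of the new reflected position
  \<open>H - (q + x)\<close> the surviving payoff has the old shape, with the rates exchanged and
  \<open>\<beta>\<close> multiplied by \<open>(s / r) * exp ((r - s) * H)\<close>; this makes the
  identity iterable.\<close>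

lemma (in prob_space) walk_step:
  fixes X :: "nat \<Rightarrow> 'a \<Rightarrow> real" and r s z H \<alpha> \<beta> :: real
  defines "Z \<equiv> \<lambda>n \<omega>. walk H z (\<lambda>k. X k \<omega>) n"
  assumes ind: "indep_vars (\<lambda>_. borel) X UNIV"
    and X: "distributed M lborel (X n) (exponential_density r)"
    and r: "0 < r" and s: "0 < s" and z: "z \<le> H" and H: "0 \<le> H"
  shows "expectation (\<lambda>\<omega>. if 0 \<le> Z n \<omega> then \<alpha> + \<beta> * exp ((r - s) * Z n \<omega>) else 0)
    = (\<alpha> + \<beta> * exp ((r - s) * H)) * prob {\<omega> \<in> space M. exits H z (\<lambda>k. X k \<omega>) n}
      + expectation (\<lambda>\<omega>. if 0 \<le> Z (Suc n) \<omega>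
          then \<alpha> + \<beta> * (s / r) * exp ((r - s) * H) * exp ((s - r) * Z (Suc n) \<omega>) else 0)"
proof -
  let ?c = "\<alpha> + \<beta> * exp ((r - s) * H)"
  let ?g = "\<lambda>q x. if H < q + x then ?c
    else if 0 \<le> x \<and> q + x < H then \<alpha> + \<beta> * (s / r) * exp ((r - s) * (q + x)) else 0"
  \<comment> \<open>The lower bound on \<open>q\<close> removes the dead walk at \<open>-1\<close>
    and keeps the exponential bounded on the whole plane.\<close>
  let ?f = "\<lambda>q x. if 0 \<le> q \<and> q \<le> H then ?g q x else 0"
  let ?h = "\<lambda>\<omega>. if 0 \<le> Z (Suc n) \<omega>
    then \<alpha> + \<beta> * (s / r) * exp ((r - s) * H) * exp ((s - r) * Z (Suc n) \<omega>) else 0"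
  let ?E = "{\<omega> \<in> space M. exits H z (\<lambda>k. X k \<omega>) n}"
  have X_meas [measurable]: "random_variable borel (X k)" for k
    using ind by (auto simp: indep_vars_def)
  have Z_meas [measurable]: "random_variable borel (Z k)" for k
    unfolding Z_def by (rule measurable_walk) simp
  have Z_le: "Z k \<omega> \<le> H" for k \<omega>
    unfolding Z_def using z H by (rule walk_le)
  have E_meas [measurable]: "?E \<in> events"
    unfolding exits_def Z_def[symmetric] using Z_meas[unfolded Z_def] by measurable
  \<comment> \<open>Dominates both exponentials on \<open>[0, H]\<close>, whatever the sign of
    \<open>r - s\<close>.\<close>
  let ?K = "exp (\<bar>r - s\<bar> * H)"
  define K1 K2 where "K1 = \<bar>\<beta>\<bar> * ?K" and "K2 = \<bar>\<beta> * (s / r)\<bar> * ?K"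
  have K_nonneg: "0 \<le> K1" "0 \<le> K2" unfolding K1_def K2_def by (rule mult_nonneg_nonneg; simp)+
  have exp_bound: "exp ((r - s) * y) \<le> ?K" "exp ((s - r) * y) \<le> ?K" if "0 \<le> y" "y \<le> H" for y
  proof -
    have "\<bar>r - s\<bar> * y \<le> \<bar>r - s\<bar> * H" "(r - s) * y \<le> \<bar>r - s\<bar> * y" "(s - r) * y \<le> \<bar>r - s\<bar> * y"
      using that by (auto intro!: mult_left_mono mult_right_mono)
    then show "exp ((r - s) * y) \<le> ?K" "exp ((s - r) * y) \<le> ?K" by auto
  qed
  have bound: "\<bar>\<alpha> + w * e\<bar> \<le> \<bar>\<alpha>\<bar> + \<bar>w\<bar> * ?K" if "0 \<le> e" "e \<le> ?K" for w e :: real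
  proof -
    have "\<bar>\<alpha> + w * e\<bar> \<le> \<bar>\<alpha>\<bar> + \<bar>w\<bar> * e"
      using abs_triangle_ineq[of \<alpha> "w * e"] that by (simp add: abs_mult)
    also have "\<dots> \<le> \<bar>\<alpha>\<bar> + \<bar>w\<bar> * ?K" using that by (intro add_left_mono mult_left_mono) auto
    finally show ?thesis .
  qed
  have f_bound: "\<bar>?f q x\<bar> \<le> \<bar>\<alpha>\<bar> + K1 + K2" for q x
  proof -
    have "\<bar>?c\<bar> \<le> \<bar>\<alpha>\<bar> + K1"
      unfolding K1_def using exp_bound(1)[of H] H by (intro bound) auto
    moreover have "\<bar>\<alpha> + \<beta> * (s / r) * exp ((r - s) * (q + x))\<bar> \<le> \<bar>\<alpha>\<bar> + K2"
      if "0 \<le> q" "0 \<le> x" "q + x < H"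
      unfolding K2_def using exp_bound(1)[of "q + x"] that by (intro bound) auto
    ultimately show ?thesis using K_nonneg by (smt (verit))
  qed
  have iE: "integrable M (\<lambda>\<omega>. ?c * indicator ?E \<omega>)"
    by (intro integrable_mult_right integrable_real_indicator E_meas) (simp add: less_top[symmetric])
  have "\<bar>?h \<omega>\<bar> \<le> \<bar>\<alpha>\<bar> + \<bar>\<beta> * (s / r) * exp ((r - s) * H)\<bar> * ?K" for \<omega>
    using exp_bound(2)[of "Z (Suc n) \<omega>"] Z_le[of "Suc n" \<omega>]
      bound[of "exp ((s - r) * Z (Suc n) \<omega>)" "\<beta> * (s / r) * exp ((r - s) * H)"]
    by auto
  then have ih: "integrable M ?h"
    by (intro integrable_const_bound[where B = "\<bar>\<alpha>\<bar> + \<bar>\<beta> * (s / r) * exp ((r - s) * H)\<bar> * ?K"]) auto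
  have "expectation (\<lambda>\<omega>. ?f (Z n \<omega>) (X n \<omega>)) = expectation (\<lambda>\<omega>. expectation (\<lambda>\<omega>'. ?f (Z n \<omega>) (X n \<omega>')))"
  proof (rule expectation_indep_pair[where f = ?f, OF _ _ f_bound])
    show "indep_var borel (Z n) borel (X n)"
      unfolding Z_def using ind by (rule indep_walk)
  qed measurable
  also have "\<dots> = expectation (\<lambda>\<omega>. if 0 \<le> Z n \<omega> then \<alpha> + \<beta> * exp ((r - s) * Z n \<omega>) else 0)"
    using expectation_exponential_step[OF X r s Z_le, where \<alpha> = \<alpha> and \<beta> = \<beta>] Z_le
    by (intro Bochner_Integration.integral_cong) auto
  also have "expectation (\<lambda>\<omega>. ?f (Z n \<omega>) (X n \<omega>)) = expectation (\<lambda>\<omega>. ?c * indicator ?E \<omega> + ?h \<omega>)"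
  proof (rule Bochner_Integration.integral_cong[OF refl])
    fix \<omega> assume \<omega>: "\<omega> \<in> space M"
    have "exp ((r - s) * H) * exp ((s - r) * (H - y)) = exp ((r - s) * y)" for y
      by (simp add: exp_add[symmetric] algebra_simps)
    then show "?f (Z n \<omega>) (X n \<omega>) = ?c * indicator ?E \<omega> + ?h \<omega>"
      using \<omega> Z_le[of n \<omega>] by (auto simp: Z_def exits_def mult.assoc)
  qed
  also have "\<dots> = ?c * prob ?E + expectation ?h"
    using ih iE by (subst Bochner_Integration.integral_add) auto
  finally show ?thesis by simp
qed

section \<open>Survival and optional stopping\<close>

text \<open>Surviving move \<open>n\<close> forces that move to be at most \<open>H\<close>. This is
  independent of survival up to \<open>n\<close> and has probability at most
  \<open>1 - exp (- (H * R))\<close>.\<close>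

lemma (in prob_space) walk_alive_decay:
  fixes X :: "nat \<Rightarrow> 'a \<Rightarrow> real" and z H c :: real
  assumes ind: "indep_vars (\<lambda>_. borel) X UNIV"
    and X: "\<And>n. distributed M lborel (X n) (exponential_density (r n))"
    and r: "\<And>n. 0 < r n" "\<And>n. r n \<le> R" and H: "0 \<le> H"
  shows "prob {\<omega> \<in> space M. 0 \<le> walk H z (\<lambda>k. X k \<omega>) n} \<le> (1 - exp (- (H * R))) ^ n"
proof (induction n)
  case (Suc n)
  have [measurable]: "random_variable borel (X k)" for k
    using ind by (auto simp: indep_vars_def)
  let ?Z = "\<lambda>\<omega>. walk H z (\<lambda>k. X k \<omega>) n"
  have "prob {\<omega> \<in> space M. 0 \<le> walk H z (\<lambda>k. X k \<omega>) (Suc n)}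
      \<le> prob (\<Inter>b\<in>UNIV. case_bool ?Z (X n) b -` case_bool {0..} {..H} b \<inter> space M)"
    by (intro finite_measure_mono) (auto simp: UNIV_bool split: if_splits)
  also have "\<dots> = (\<Prod>b\<in>UNIV. prob (case_bool ?Z (X n) b -` case_bool {0..} {..H} b \<inter> space M))"
    using indep_walk[OF ind, of H z n] unfolding indep_var_def
    by (rule indep_varsD) (auto split: bool.splits)
  also have "\<dots> = prob {\<omega> \<in> space M. 0 \<le> ?Z \<omega>} * prob {\<omega> \<in> space M. X n \<omega> \<le> H}"
    by (simp add: UNIV_bool vimage_def Int_def conj_commute)
  also have "prob {\<omega> \<in> space M. X n \<omega> \<le> H} = 1 - exp (- (H * r n))"
    using exponential_distributedD_le[OF X H] r by simp
  also have "prob {\<omega> \<in> space M. 0 \<le> ?Z \<omega>} * (1 - exp (- (H * r n)))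
      \<le> (1 - exp (- (H * R))) ^ n * (1 - exp (- (H * R)))"
    using Suc r H order_trans[OF less_imp_le[OF r(1)] r(2)]
    by (intro mult_mono) (auto intro!: mult_left_mono mult_nonneg_nonneg less_imp_le[OF r(1)])
  finally show ?case by (simp add: mult.commute)
qed simp

text \<open>Either start of the particle is the point \<open>0\<close> of the reflected picture; the
  order of the rates \<open>a\<close>, \<open>b\<close> tells which one is meant. Almost sure exit
  is a by-product: the even and odd probabilities add up to one.\<close>

lemma (in prob_space) exit_probability:
  fixes X :: "nat \<Rightarrow> 'a \<Rightarrow> real" and a b H :: real
  assumes ind: "indep_vars (\<lambda>_. borel) X UNIV"
    and X: "\<And>n. distributed M lborel (X n) (exponential_density (if even n then a else b))"
    and pos: "0 < a" "0 < b" "0 < H" and "a \<noteq> b"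
  shows exit_even_probability:
      "prob {\<omega> \<in> space M. \<exists>n. even n \<and> exits H 0 (\<lambda>k. X k \<omega>) n} = (b - a) / (b - a * exp ((a - b) * H))"
    and exit_AE: "AE \<omega> in M. \<exists>n. exits H 0 (\<lambda>k. X k \<omega>) n"
    and exits_measurable: "\<And>n. {\<omega> \<in> space M. exits H 0 (\<lambda>k. X k \<omega>) n} \<in> events"
proof -
  define r where "r n = (if even n then a else b)" for n :: nat
  have r_pos: "0 < r n" for n using pos by (simp add: r_def)
  let ?Z = "\<lambda>n \<omega>. walk H 0 (\<lambda>k. X k \<omega>) n"
  let ?A = "\<lambda>n. {\<omega> \<in> space M. exits H 0 (\<lambda>k. X k \<omega>) n}"
  have X_meas [measurable]: "random_variable borel (X k)" for k
    using ind by (auto simp: indep_vars_def)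
  show A_meas [measurable]: "?A n \<in> events" for n
    unfolding exits_def by measurable
  let ?even = "{\<omega> \<in> space M. \<exists>n. even n \<and> exits H 0 (\<lambda>k. X k \<omega>) n}"
  let ?odd = "{\<omega> \<in> space M. \<exists>n. odd n \<and> exits H 0 (\<lambda>k. X k \<omega>) n}"
  have sums: "(\<lambda>n. if P n then prob (?A n) else 0) sums prob {\<omega> \<in> space M. \<exists>n. P n \<and> exits H 0 (\<lambda>k. X k \<omega>) n}"
    for P :: "nat \<Rightarrow> bool"
  proof -
    let ?B = "\<lambda>n. if P n then ?A n else {}"
    have "(\<lambda>n. prob (?B n)) sums prob (\<Union>n. ?B n)"
      by (rule finite_measure_UNION) (auto simp: disjoint_family_on_def dest: exits_unique)
    moreover have "(\<Union>n. ?B n) = {\<omega> \<in> space M. \<exists>n. P n \<and> exits H 0 (\<lambda>k. X k \<omega>) n}"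
      by (auto split: if_splits)
    ultimately show ?thesis by (simp add: if_distrib[of prob] cong: if_cong)
  qed
  have key: "(\<alpha> + \<beta> * exp ((a - b) * H)) * prob ?even + (\<alpha> + \<beta> * (b / a)) * prob ?odd = \<alpha> + \<beta>" for \<alpha> \<beta>
  proof -
    \<comment> \<open>Solves the recursion for the coefficient of the exponential under
      \<open>walk_step\<close>. It has period two, because the factors of an even and of an odd move
      multiply to one.\<close>
    define \<gamma> where "\<gamma> n = (if even n then \<beta> else \<beta> * (b / a) * exp ((a - b) * H))" for n :: nat
    \<comment> \<open>The value paid by an exit at time \<open>n\<close>:
      \<open>\<alpha> + \<beta> * exp ((a - b) * H)\<close> for even \<open>n\<close> and
      \<open>\<alpha> + \<beta> * (b / a)\<close> for odd \<open>n\<close>.\<close>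
    define c where "c n = \<alpha> + \<gamma> n * exp ((r n - r (Suc n)) * H)" for n
    define h where "h n \<omega> = (if 0 \<le> ?Z n \<omega> then \<alpha> + \<gamma> n * exp ((r n - r (Suc n)) * ?Z n \<omega>) else 0)" for n \<omega>
    have \<gamma>_Suc: "\<gamma> (Suc n) = \<gamma> n * (r (Suc n) / r n) * exp ((r n - r (Suc n)) * H)" for n
      using pos by (simp add: \<gamma>_def r_def exp_add[symmetric] algebra_simps)
    have step: "expectation (h n) = c n * prob (?A n) + expectation (h (Suc n))" for n
    proof -
      have "r (Suc (Suc n)) = r n" by (simp add: r_def)
      then show ?thesis
        using walk_step[OF ind X[of n, folded r_def] r_pos[of n] r_pos[of "Suc n"], of 0 H \<alpha> "\<gamma> n"] pos
        unfolding h_def c_def \<gamma>_Suc \<open>r (Suc (Suc n)) = r n\<close> by simp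
    qed
    have "h 0 = (\<lambda>_. \<alpha> + \<beta>)"
      by (simp add: h_def \<gamma>_def fun_eq_iff)
    then have h0: "expectation (h 0) = \<alpha> + \<beta>"
      by (simp add: prob_space)
    have partial: "(\<Sum>k<n. c k * prob (?A k)) = \<alpha> + \<beta> - expectation (h n)" for n
    proof (induction n)
      case (Suc n)
      then show ?case using step[of n] by simp
    qed (simp add: h0)
    \<comment> \<open>Uniform in \<open>n\<close>: the sum of the absolute values of the two values
      of \<open>\<gamma>\<close> bounds either of them.\<close>
    define K where "K = \<bar>\<alpha>\<bar> + (\<bar>\<beta>\<bar> + \<bar>\<beta> * (b / a) * exp ((a - b) * H)\<bar>) * exp (\<bar>a - b\<bar> * H)"
    have K: "0 \<le> K" unfolding K_def by (intro add_nonneg_nonneg mult_nonneg_nonneg) auto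
    have h_bound: "\<bar>h n \<omega>\<bar> \<le> K * indicator {\<omega> \<in> space M. 0 \<le> ?Z n \<omega>} \<omega>" if "\<omega> \<in> space M" for n \<omega>
    proof (cases "0 \<le> ?Z n \<omega>")
      case True
      have le: "?Z n \<omega> \<le> H" using pos by (intro walk_le) auto
      have "(r n - r (Suc n)) * ?Z n \<omega> \<le> \<bar>a - b\<bar> * ?Z n \<omega>"
        using True by (intro mult_right_mono) (auto simp: r_def)
      also have "\<dots> \<le> \<bar>a - b\<bar> * H" using le by (intro mult_left_mono) auto
      finally have "exp ((r n - r (Suc n)) * ?Z n \<omega>) \<le> exp (\<bar>a - b\<bar> * H)" by simp
      moreover have "\<bar>\<gamma> n\<bar> \<le> \<bar>\<beta>\<bar> + \<bar>\<beta> * (b / a) * exp ((a - b) * H)\<bar>"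
        unfolding \<gamma>_def by simp
      ultimately have "\<bar>\<gamma> n\<bar> * exp ((r n - r (Suc n)) * ?Z n \<omega>) \<le> K - \<bar>\<alpha>\<bar>"
        unfolding K_def add_diff_cancel_left' by (intro mult_mono) auto
      then show ?thesis
        using True that abs_triangle_ineq[of \<alpha> "\<gamma> n * exp ((r n - r (Suc n)) * ?Z n \<omega>)"]
        by (simp add: h_def abs_mult)
    qed (simp add: h_def)
    have h_meas [measurable]: "random_variable borel (h n)" for n
      unfolding h_def by measurable
    \<comment> \<open>\<open>h n\<close> is bounded by \<open>K\<close> and vanishes off survival,
      so the remainder of the telescoped sum decays with the survival probability.\<close>
    have "\<bar>expectation (h n)\<bar> \<le> K * (1 - exp (- (H * max a b))) ^ n" for n
    proof -
      have "\<bar>expectation (h n)\<bar> \<le> expectation (\<lambda>\<omega>. \<bar>h n \<omega>\<bar>)"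
        by (rule integral_abs_bound)
      also have "\<dots> \<le> expectation (\<lambda>\<omega>. K * indicator {\<omega> \<in> space M. 0 \<le> ?Z n \<omega>} \<omega>)"
      proof (rule integral_mono_AE)
        have "\<bar>h n \<omega>\<bar> \<le> K" if "\<omega> \<in> space M" for \<omega>
          using h_bound[OF that, of n] K that by (cases "0 \<le> ?Z n \<omega>") auto
        then show "integrable M (\<lambda>\<omega>. \<bar>h n \<omega>\<bar>)"
          by (intro integrable_const_bound[where B = K]) auto
        show "integrable M (\<lambda>\<omega>. K * indicator {\<omega> \<in> space M. 0 \<le> ?Z n \<omega>} \<omega>)"
          by (intro integrable_mult_right integrable_real_indicator) (auto simp: less_top[symmetric])
      qed (use h_bound in auto)
      also have "\<dots> = K * prob {\<omega> \<in> space M. 0 \<le> ?Z n \<omega>}" by simp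
      also have "\<dots> \<le> K * (1 - exp (- (H * max a b))) ^ n"
        using K pos by (intro mult_left_mono walk_alive_decay[OF ind X]) auto
      finally show ?thesis .
    qed
    moreover have "(\<lambda>n. K * (1 - exp (- (H * max a b))) ^ n) \<longlonglongrightarrow> 0"
      using pos by (intro tendsto_mult_right_zero LIMSEQ_power_zero) auto
    ultimately have "(\<lambda>n. expectation (h n)) \<longlonglongrightarrow> 0"
      by (intro Lim_null_comparison[of "\<lambda>n. expectation (h n)"]) (auto intro: always_eventually)
    then have "(\<lambda>n. \<Sum>k<n. c k * prob (?A k)) \<longlonglongrightarrow> \<alpha> + \<beta> - 0"
      unfolding partial by (intro tendsto_intros)
    then have "(\<lambda>n. c n * prob (?A n)) sums (\<alpha> + \<beta>)"
      by (simp add: sums_def)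
    moreover have "(\<lambda>n. c n * prob (?A n)) =
        (\<lambda>n. (\<alpha> + \<beta> * exp ((a - b) * H)) * (if even n then prob (?A n) else 0)
            + (\<alpha> + \<beta> * (b / a)) * (if odd n then prob (?A n) else 0))"
    proof
      fix n
      have "exp ((a - b) * H) * exp ((b - a) * H) = 1"
        by (simp add: exp_add[symmetric] algebra_simps)
      then show "c n * prob (?A n) = (\<alpha> + \<beta> * exp ((a - b) * H)) * (if even n then prob (?A n) else 0)
            + (\<alpha> + \<beta> * (b / a)) * (if odd n then prob (?A n) else 0)"
        by (simp add: c_def \<gamma>_def r_def mult.assoc)
    qed
    moreover have "(\<lambda>n. (\<alpha> + \<beta> * exp ((a - b) * H)) * (if even n then prob (?A n) else 0)
            + (\<alpha> + \<beta> * (b / a)) * (if odd n then prob (?A n) else 0))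
        sums ((\<alpha> + \<beta> * exp ((a - b) * H)) * prob ?even + (\<alpha> + \<beta> * (b / a)) * prob ?odd)"
      by (intro sums_add sums_mult sums)
    ultimately show ?thesis
      by (simp only: sums_unique2)
  qed
  \<comment> \<open>The constant martingale shows that an exit is almost sure; the purely
    exponential one then gives the second linear equation.\<close>
  have total: "prob ?even + prob ?odd = 1"
    using key[of 1 0] by simp
  have eq: "exp ((a - b) * H) * prob ?even + b / a * prob ?odd = 1"
    using key[of 0 1] by simp
  have "b * (1 - prob ?even) + a * exp ((a - b) * H) * prob ?even = a"
  proof -
    have "prob ?odd = 1 - prob ?even" using total by simp
    from eq[unfolded this] show ?thesis using pos by (simp add: field_simps)
  qed
  then have "prob ?even * (b - a * exp ((a - b) * H)) = b - a"
    by (simp add: algebra_simps)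
  \<comment> \<open>A vanishing denominator would make the product zero, but it equals
    \<open>b - a\<close>.\<close>
  moreover from this have "b - a * exp ((a - b) * H) \<noteq> 0"
    using \<open>a \<noteq> b\<close> by auto
  ultimately show "prob ?even = (b - a) / (b - a * exp ((a - b) * H))"
    by (simp add: field_simps)
  have "prob (?even \<union> ?odd) = prob ?even + prob ?odd"
    by (rule finite_measure_Union) (auto dest: exits_unique)
  moreover have "?even \<union> ?odd = {\<omega> \<in> space M. \<exists>n. exits H 0 (\<lambda>k. X k \<omega>) n}"
    by auto
  ultimately have "prob {\<omega> \<in> space M. \<exists>n. exits H 0 (\<lambda>k. X k \<omega>) n} = 1"
    using total by simp
  moreover have "{\<omega> \<in> space M. \<exists>n. exits H 0 (\<lambda>k. X k \<omega>) n} \<in> events"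
    by measurable
  ultimately show "AE \<omega> in M. \<exists>n. exits H 0 (\<lambda>k. X k \<omega>) n"
    using prob_Collect_eq_1[of "\<lambda>\<omega>. \<exists>n. exits H 0 (\<lambda>k. X k \<omega>) n"] by simp
qed

section \<open>Measurability of the hitting times\<close>

text \<open>
  As \<open>M\<close> need not be complete, the events in question must be measurable even on the null set where
  the path is degenerate (negative steps, or infinitely many of them in finite time). An infimum
  over an uncountable set of times is reduced to countably many measurable candidate times.
\<close>

lemma borel_measurable_Inf_countable:
  fixes S :: "'a \<Rightarrow> real set"
  assumes "countable Q"
    and Q: "\<And>q. q \<in> Q \<Longrightarrow> q \<in> borel_measurable M"
    and S: "\<And>q. q \<in> Q \<Longrightarrow> Measurable.pred M (\<lambda>\<omega>. q \<omega> \<in> S \<omega>)"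
    and dense: "\<And>\<omega> t e. \<omega> \<in> space M \<Longrightarrow> t \<in> S \<omega> \<Longrightarrow> t < e \<Longrightarrow> \<exists>q\<in>Q. q \<omega> \<in> S \<omega> \<and> q \<omega> < e"
  shows "(\<lambda>\<omega>. Inf (ereal ` S \<omega>)) \<in> borel_measurable M"
proof -
  \<comment> \<open>A candidate outside \<open>S \<omega>\<close> contributes
    \<open>\<infinity>\<close> and leaves the infimum unchanged.\<close>
  let ?f = "\<lambda>q \<omega>. if q \<omega> \<in> S \<omega> then ereal (q \<omega>) else \<infinity>"
  have "Inf (ereal ` S \<omega>) = (INF q\<in>Q. ?f q \<omega>)" if \<omega>: "\<omega> \<in> space M" for \<omega>
  proof (rule antisym)
    show "Inf (ereal ` S \<omega>) \<le> (INF q\<in>Q. ?f q \<omega>)"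
      by (intro INF_greatest) (auto intro: INF_lower)
    show "(INF q\<in>Q. ?f q \<omega>) \<le> Inf (ereal ` S \<omega>)"
    proof (rule INF_greatest)
      fix t assume t: "t \<in> S \<omega>"
      show "(INF q\<in>Q. ?f q \<omega>) \<le> ereal t"
      proof (rule dense_ge)
        fix e assume "ereal t < e"
        then obtain e' where e': "ereal t < ereal e'" "ereal e' < e"
          using ereal_dense2 by blast
        then obtain q where "q \<in> Q" "q \<omega> \<in> S \<omega>" "q \<omega> < e'"
          using dense[OF \<omega> t, of e'] by auto
        then have "(INF q\<in>Q. ?f q \<omega>) \<le> ereal e'"
          by (intro INF_lower2[of q]) auto
        then show "(INF q\<in>Q. ?f q \<omega>) \<le> e" using e' by simp
      qed
    qed
  qed
  moreover have "(\<lambda>\<omega>. INF q\<in>Q. ?f q \<omega>) \<in> borel_measurable M"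
  proof (rule borel_measurable_INF[OF \<open>countable Q\<close>])
    fix q assume "q \<in> Q"
    note Q[OF this, measurable] S[OF this, measurable]
    show "?f q \<in> borel_measurable M" by measurable
  qed
  ultimately show ?thesis by (simp cong: measurable_cong)
qed

text \<open>The count takes countably many values, and for each value the down time is a finite sum.
  The time \<open>q\<close> may be random, since the candidate times depend on the path.\<close>

lemma measurable_downtime:
  fixes U D :: "nat \<Rightarrow> 'a \<Rightarrow> real"
  assumes UD: "\<And>n. n \<ge> 1 \<Longrightarrow> U n \<in> borel_measurable M" "\<And>n. n \<ge> 1 \<Longrightarrow> D n \<in> borel_measurable M"
    and [measurable]: "q \<in> borel_measurable M"
  shows "(\<lambda>\<omega>. downtime U D (q \<omega>) \<omega>) \<in> borel_measurable M"
  unfolding downtime_def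
proof (rule measurable_compose_countable[where f = "\<lambda>n \<omega>. \<Sum>i=1..n. D i \<omega>"])
  show "(\<lambda>\<omega>. \<Sum>i=1..n. D i \<omega>) \<in> borel_measurable M" for n
    using UD by (intro borel_measurable_sum) auto
  have [measurable]: "(\<lambda>\<omega>. \<Sum>i=1..n. U i \<omega>) \<in> borel_measurable M" for n
    using UD by (intro borel_measurable_sum) auto
  show "(\<lambda>\<omega>. upcount U (q \<omega>) \<omega>) \<in> measurable M (count_space UNIV)"
    unfolding upcount_def
  proof (rule measurable_Max_nat)
    show "Measurable.pred M (\<lambda>\<omega>. (\<Sum>i=1..n. U i \<omega>) \<le> q \<omega>)" for n
      by measurable
  qed
qed

text \<open>The down time takes only the values of the partial sums of \<open>D\<close>, so every
  solution \<open>t\<close> is itself one of the countably many times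
  \<open>(\<Sum>i=1..n. D i \<omega>) + d \<omega>\<close>.\<close>

lemma borel_measurable_hitting_eq:
  fixes U D :: "nat \<Rightarrow> 'a \<Rightarrow> real"
  assumes UD: "\<And>n. n \<ge> 1 \<Longrightarrow> U n \<in> borel_measurable M" "\<And>n. n \<ge> 1 \<Longrightarrow> D n \<in> borel_measurable M"
    and [measurable]: "d \<in> borel_measurable M"
  shows "(\<lambda>\<omega>. Inf (ereal ` {t. c \<le> t \<and> downtime U D t \<omega> = t - d \<omega>})) \<in> borel_measurable M"
proof (rule borel_measurable_Inf_countable[where Q = "range (\<lambda>n \<omega>. (\<Sum>i=1..n. D i \<omega>) + d \<omega>)"])
  have [measurable]: "(\<lambda>\<omega>. \<Sum>i=1..n. D i \<omega>) \<in> borel_measurable M" for n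
    by (intro borel_measurable_sum) (simp add: UD)
  show q: "q \<in> borel_measurable M" if "q \<in> range (\<lambda>n \<omega>. (\<Sum>i=1..n. D i \<omega>) + d \<omega>)" for q
    using that by (auto simp del: One_nat_def)
  fix q assume "q \<in> range (\<lambda>n \<omega>. (\<Sum>i=1..n. D i \<omega>) + d \<omega>)"
  from q[OF this] have [measurable]: "q \<in> borel_measurable M" .
  note measurable_downtime[where q = q, OF UD, measurable]
  show "Measurable.pred M (\<lambda>\<omega>. q \<omega> \<in> {t. c \<le> t \<and> downtime U D t \<omega> = t - d \<omega>})"
    by simp
next
  fix \<omega> t e assume "t \<in> {t. c \<le> t \<and> downtime U D t \<omega> = t - d \<omega>}" "t < e"
  then show "\<exists>q\<in>range (\<lambda>n \<omega>. (\<Sum>i=1..n. D i \<omega>) + d \<omega>).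
      q \<omega> \<in> {t. c \<le> t \<and> downtime U D t \<omega> = t - d \<omega>} \<and> q \<omega> < e"
    by (intro bexI[of _ "\<lambda>\<omega>'. (\<Sum>i=1..upcount U t \<omega>. D i \<omega>') + d \<omega>'"] rangeI)
      (simp add: downtime_def)
qed simp

text \<open>The down time is constant between jumps while the bound
  \<open>t - d \<omega> + H\<close> increases, so a solution may be moved left to the last jump.
  Rationals handle a last jump at or before \<open>0\<close>, where \<open>P\<close> may fail;
  together with the times where the bound is attained they also handle paths with an infinite set of
  counts.\<close>

lemma borel_measurable_hitting_ge:
  fixes U D :: "nat \<Rightarrow> 'a \<Rightarrow> real"
  assumes UD: "\<And>n. n \<ge> 1 \<Longrightarrow> U n \<in> borel_measurable M" "\<And>n. n \<ge> 1 \<Longrightarrow> D n \<in> borel_measurable M"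
    and [measurable]: "d \<in> borel_measurable M" "Measurable.pred borel P"
    and P: "\<And>t. 0 < t \<Longrightarrow> P t" "\<And>t. P t \<Longrightarrow> 0 \<le> t"
  shows "(\<lambda>\<omega>. Inf (ereal ` {t. P t \<and> downtime U D t \<omega> \<ge> t - d \<omega> + H})) \<in> borel_measurable M"
    (is "(\<lambda>\<omega>. Inf (ereal ` ?S \<omega>)) \<in> _")
proof -
  define \<sigma> where "\<sigma> n \<omega> = (\<Sum>i=1..n. U i \<omega>)" for n \<omega>
  define Y where "Y n \<omega> = (\<Sum>i=1..n. D i \<omega>)" for n \<omega>
  have meas [measurable]: "\<sigma> n \<in> borel_measurable M" "Y n \<in> borel_measurable M" for n
    unfolding \<sigma>_def Y_def by (intro borel_measurable_sum; simp add: UD)+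
  let ?Q = "range (\<lambda>(r::rat) \<omega>. of_rat r) \<union> range \<sigma> \<union> range (\<lambda>n \<omega>. Y n \<omega> + d \<omega> - H)"
  show ?thesis
  proof (rule borel_measurable_Inf_countable[where Q = ?Q])
    show q: "q \<in> borel_measurable M" if "q \<in> ?Q" for q
      using that by auto
    fix q assume "q \<in> ?Q"
    from q[OF this] have [measurable]: "q \<in> borel_measurable M" .
    note measurable_downtime[where q = q, OF UD, measurable]
    show "Measurable.pred M (\<lambda>\<omega>. q \<omega> \<in> ?S \<omega>)"
      by simp
  next
    fix \<omega> t e assume t: "t \<in> ?S \<omega>" and e: "t < e"
    define N where "N = upcount U t \<omega>"
    have t0: "0 \<le> t" and Yt: "t - d \<omega> + H \<le> Y N \<omega>"
      using t P(2) by (auto simp: N_def downtime_def Y_def)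
    have Q: "(\<lambda>_. of_rat r) \<in> ?Q" "\<sigma> n \<in> ?Q" "(\<lambda>\<omega>. Y n \<omega> + d \<omega> - H) \<in> ?Q" for r n
      by blast+
    have mem: "s \<in> ?S \<omega>" if "P s" "upcount U s \<omega> = N" "s - d \<omega> + H \<le> Y N \<omega>" for s
      using that by (simp add: downtime_def Y_def)
    show "\<exists>q\<in>?Q. q \<omega> \<in> ?S \<omega> \<and> q \<omega> < e"
    proof (cases "finite {m. \<sigma> m \<omega> \<le> t}")
      case True
      have N: "N = Max {m. \<sigma> m \<omega> \<le> t}" by (simp add: N_def upcount_def \<sigma>_def)
      have "0 \<in> {m. \<sigma> m \<omega> \<le> t}" using t0 by (simp add: \<sigma>_def)
      then have \<sigma>N: "\<sigma> N \<omega> \<le> t" using Max_in[OF True] unfolding N by blast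
      have N_max: "m \<le> N" if "\<sigma> m \<omega> \<le> t" for m
        unfolding N using that True by (intro Max_ge) auto
      \<comment> \<open>On a degenerate path the partial sums need not increase, but the set for
        \<open>s\<close> still lies inside the set for \<open>t\<close> and contains its maximum
        \<open>N\<close>.\<close>
      have same: "upcount U s \<omega> = N" if "\<sigma> N \<omega> \<le> s" "s \<le> t" for s
      proof -
        have "{m. \<sigma> m \<omega> \<le> s} \<subseteq> {m. \<sigma> m \<omega> \<le> t}" using that by auto
        moreover from this have "finite {m. \<sigma> m \<omega> \<le> s}" using True finite_subset by blast
        ultimately show ?thesis
          unfolding upcount_def \<sigma>_def[symmetric] using that N_max
          by (intro Max_eqI) auto
      qed
      consider "0 < \<sigma> N \<omega>" | "t = 0" | "\<sigma> N \<omega> \<le> 0" "0 < t" using t0 by linarith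
      then show ?thesis
      proof cases
        case 1
        then have "\<sigma> N \<omega> \<in> ?S \<omega>" using \<sigma>N Yt by (intro mem same P) auto
        then show ?thesis using \<sigma>N e by (intro bexI[OF _ Q(2)[of N]]) simp
      next
        case 2
        then show ?thesis using t e by (intro bexI[OF _ Q(1)[of 0]]) simp
      next
        case 3
        then obtain r :: rat where r: "0 < real_of_rat r" "real_of_rat r < t" using of_rat_dense[OF 3(2)] by blast
        then have "of_rat r \<in> ?S \<omega>" using 3 r Yt by (intro mem same P; linarith)
        then show ?thesis using r e by (intro bexI[OF _ Q(1)[of r]]) simp
      qed
    next
      case False
      \<comment> \<open>With infinitely many partial sums below \<open>t\<close>, \<open>Max\<close>
        is the same unspecified value at every later time. Hence \<open>t\<close> may be moved right
        to a rational, unless the constraint is tight; then \<open>t\<close> itself is a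
        candidate.\<close>
      have same: "upcount U s \<omega> = N" if "t \<le> s" for s
      proof -
        have "{m. \<sigma> m \<omega> \<le> t} \<subseteq> {m. \<sigma> m \<omega> \<le> s}" using that by auto
        then have "infinite {m. \<sigma> m \<omega> \<le> s}" using False finite_subset by blast
        then show ?thesis
          using False by (simp add: N_def upcount_def \<sigma>_def Max.infinite)
      qed
      show ?thesis
      proof (cases "t = Y N \<omega> + d \<omega> - H")
        case True
        then show ?thesis using t e by (intro bexI[OF _ Q(3)[of N]]) simp
      next
        case False
        then have "t < min e (Y N \<omega> + d \<omega> - H)" using Yt e by auto
        then obtain r :: rat where r: "t < real_of_rat r" "real_of_rat r < min e (Y N \<omega> + d \<omega> - H)"
          using of_rat_dense[of t "min e (Y N \<omega> + d \<omega> - H)"] by blast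
        then have "of_rat r \<in> ?S \<omega>" using t0 by (intro mem same P; linarith)
        then show ?thesis using r by (intro bexI[OF _ Q(1)[of r]]) simp
      qed
    qed
  qed (auto intro!: countable_Un)
qed

section \<open>Hitting times and exits\<close>

text \<open>Positive up times make the partial sums increase, so the set under \<open>Max\<close> is
  the initial segment \<open>{..n}\<close>.\<close>

lemma upcount_eqI:
  assumes U: "\<And>i. i \<ge> 1 \<Longrightarrow> 0 < U i \<omega>"
    and t: "(\<Sum>i=1..n. U i \<omega>) \<le> t" "t < (\<Sum>i=1..Suc n. U i \<omega>)"
  shows "upcount U t \<omega> = n"
proof -
  have mono: "(\<Sum>i=1..m. U i \<omega>) \<le> (\<Sum>i=1..k. U i \<omega>)" if "m \<le> k" for m k
    using that U by (intro sum_mono2) (auto intro: less_imp_le)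
  have "{m. (\<Sum>i=1..m. U i \<omega>) \<le> t} = {..n}"
  proof (intro set_eqI iffI)
    fix m assume "m \<in> {m. (\<Sum>i=1..m. U i \<omega>) \<le> t}"
    then show "m \<in> {..n}" using mono[of "Suc n" m] t by (auto simp: not_less_eq_eq[symmetric])
  next
    fix m assume "m \<in> {..n}"
    then show "m \<in> {m. (\<Sum>i=1..m. U i \<omega>) \<le> t}" using mono[of m n] t by auto
  qed
  then show ?thesis by (auto simp: upcount_def intro!: Max_eqI)
qed

lemma bracketing_index:
  fixes s :: "nat \<Rightarrow> real"
  assumes "s 0 \<le> t" "t < s m"
  shows "\<exists>k<m. s k \<le> t \<and> t < s (Suc k)"
  using assms
proof (induction m)
  case (Suc m)
  then show ?case by (cases "t < s m") (auto intro: less_SucI)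
qed simp

text \<open>The walk numbers its moves from \<open>0\<close>, whereas \<open>U\<close> and
  \<open>D\<close> are used from index \<open>1\<close> on; hence the successor.\<close>

definition alternate :: "(nat \<Rightarrow> 'a \<Rightarrow> real) \<Rightarrow> (nat \<Rightarrow> 'a \<Rightarrow> real) \<Rightarrow> nat \<Rightarrow> 'a \<Rightarrow> real" where
  "alternate U D n = (if even n then U (Suc (n div 2)) else D (Suc (n div 2)))"

lemma alternate_simps [simp]: "alternate U D (2 * k) = U (Suc k)" "alternate U D (Suc (2 * k)) = D (Suc k)"
  by (simp_all add: alternate_def)

text \<open>
  With \<open>d = H\<close> and \<open>P t \<longleftrightarrow> 0 < t\<close> this also covers the particle started at \<open>0\<close>. Below, \<open>x k\<close> is the
  distance from \<open>H\<close> at the start of the upward move \<open>k + 1\<close>.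
\<close>

lemma hitting_order:
  fixes U D :: "nat \<Rightarrow> 'a \<Rightarrow> real" and d H :: real and P :: "real \<Rightarrow> bool"
  assumes U: "\<And>i. i \<ge> 1 \<Longrightarrow> 0 < U i \<omega>"
    and H: "0 < H" and d: "0 \<le> d" "d \<le> H"
    and P: "\<And>t. 0 < t \<Longrightarrow> P t" "\<And>t. P t \<Longrightarrow> 0 \<le> t" "P 0 \<Longrightarrow> d < H"
    and ex: "exits H (H - d) (\<lambda>k. alternate U D k \<omega>) n"
  defines "B \<equiv> Inf (ereal ` {t. P t \<and> downtime U D t \<omega> \<ge> t - d + H})"
  shows "even n \<Longrightarrow> T_HH U D d \<omega> < B" and "odd n \<Longrightarrow> B < T_HH U D d \<omega>"
proof -
  define \<sigma> where "\<sigma> k = (\<Sum>i=1..k. U i \<omega>)" for k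
  define Y where "Y k = (\<Sum>i=1..k. D i \<omega>)" for k
  define x where "x k = d + Y k - \<sigma> k" for k
  let ?c = "walk H (H - d) (\<lambda>k. alternate U D k \<omega>)"
  have \<sigma>0: "\<sigma> 0 = 0" and \<sigma>_Suc: "\<sigma> (Suc k) = \<sigma> k + U (Suc k) \<omega>" for k
    by (simp_all add: \<sigma>_def)
  have x0: "x 0 = d" and x_Suc: "x (Suc k) = x k - U (Suc k) \<omega> + D (Suc k) \<omega>" for k
    by (simp_all add: x_def \<sigma>_def Y_def)
  have \<sigma>_nonneg: "0 \<le> \<sigma> k" for k
    unfolding \<sigma>_def using U by (intro sum_nonneg) (auto intro: less_imp_le)
  have \<sigma>_less: "\<sigma> k < \<sigma> (Suc k)" for k
    using U[of "Suc k"] by (simp add: \<sigma>_Suc)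
  \<comment> \<open>During upward move \<open>k + 1\<close> the distance from \<open>H\<close> is
    \<open>x k - (t - \<sigma> k)\<close>. In this form hitting \<open>H\<close> means that it is
    zero, and being at or below \<open>0\<close> that it is at least \<open>H\<close>.\<close>
  have down: "downtime U D t \<omega> = t - d + x k - (t - \<sigma> k)" if "\<sigma> k \<le> t" "t < \<sigma> (Suc k)" for t k
  proof -
    have "upcount U t \<omega> = k"
      using that unfolding \<sigma>_def by (intro upcount_eqI U)
    then show ?thesis by (simp add: downtime_def x_def Y_def)
  qed
  have c_le: "?c k \<le> H" for k using d H by (intro walk_le) auto
  \<comment> \<open>At even times the walk is the height of the particle before a rise; at odd times
    it is the reflected height, the distance from \<open>H\<close> at the top of the rise.\<close>
  have c_even: "2 * k \<le> n \<Longrightarrow> ?c (2 * k) = H - x k" for k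
  proof (induction k)
    case (Suc k)
    then show ?case
      using exits_before(3)[OF ex, of "2 * k"] exits_before(3)[OF ex, of "Suc (2 * k)"]
      by (simp add: x_Suc del: walk.simps)
  qed (simp add: x0)
  have c_odd: "?c (Suc (2 * k)) = x k - U (Suc k) \<omega>" if "2 * k < n" for k
    using that exits_before(3)[OF ex that] c_even[of k] by simp
  have x_le: "x k \<le> H" if "2 * k \<le> n" for k
  proof -
    have "0 \<le> ?c n" using ex by (simp add: exits_def)
    from walk_alive_antimono[OF this that] show ?thesis using c_even[OF that] by simp
  qed
  have x_less: "x (Suc k) < H" if "Suc (2 * k) < n" for k
    using exits_before(2)[OF ex that] c_odd[of k] that by (simp add: x_Suc)
  have U_less: "U (Suc k) \<omega> < x k" if "2 * k < n" for k
    using exits_before(2)[OF ex that] c_even[of k] that by simp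
  {
    assume "even n"
    then obtain m where n: "n = 2 * m" by (auto elim: evenE)
    have xm: "0 \<le> x m" using c_le[of "2 * m"] c_even[of m] n by simp
    have Um: "x m < U (Suc m) \<omega>" using ex c_even[of m] n by (simp add: exits_def)
    \<comment> \<open>The rise \<open>m + 1\<close> is longer than the distance \<open>x m\<close>,
      so \<open>H\<close> is hit within it, strictly before the next jump.\<close>
    have "T_HH U D d \<omega> \<le> ereal (\<sigma> m + x m)"
      unfolding T_HH_def using down[of m "\<sigma> m + x m"] xm Um \<sigma>_nonneg[of m]
      by (intro Inf_lower) (auto simp: \<sigma>_Suc)
    also have "\<dots> < ereal (\<sigma> (Suc m))" using Um by (simp add: \<sigma>_Suc)
    also have "\<dots> \<le> B"
      unfolding B_def
    proof (rule INF_greatest, rule ccontr)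
      fix t assume t: "t \<in> {t. P t \<and> downtime U D t \<omega> \<ge> t - d + H}"
        and "\<not> ereal (\<sigma> (Suc m)) \<le> ereal t"
      then obtain k where k: "k < Suc m" "\<sigma> k \<le> t" "t < \<sigma> (Suc k)"
        using bracketing_index[of \<sigma> t "Suc m"] P(2) \<sigma>0 by auto
      have "H \<le> x k - (t - \<sigma> k)" using t down[OF k(2,3)] by simp
      \<comment> \<open>Equality occurs only for \<open>d = H\<close>, the start at
        \<open>0\<close>. There the hypothesis on \<open>P 0\<close> excludes time \<open>0\<close>,
        and any positive time brings the distance below \<open>H\<close>.\<close>
      moreover have "x k < H \<or> k = 0 \<and> x k = H \<and> 0 < t"
      proof (cases k)
        case 0
        then show ?thesis using P(2)[of t] P(3) t d x0 by (cases "t = 0") auto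
      next
        case (Suc k')
        then show ?thesis using x_less[of k'] k n by simp
      qed
      ultimately show False using k \<sigma>0 by auto
    qed
    finally show "T_HH U D d \<omega> < B" .
  }
  {
    assume "odd n"
    then obtain m where n: "n = Suc (2 * m)" by (auto elim: oddE)
    have xm: "H < x (Suc m)" using ex c_odd[of m] n by (simp add: exits_def x_Suc del: walk.simps)
    have "B \<le> ereal (\<sigma> (Suc m))"
      unfolding B_def using down[of "Suc m" "\<sigma> (Suc m)"] xm \<sigma>_less[of "Suc m"] \<sigma>_less[of m] \<sigma>_nonneg[of m] P(1)
      by (intro Inf_lower) auto
    \<comment> \<open>After the jump the distance from \<open>H\<close> exceeds \<open>H\<close>, so
      more than \<open>H\<close> further upward time is needed. The minimum with the next rise stays
      in the interval where \<open>down\<close> applies and gives a strict gap.\<close>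
    also have "\<dots> < ereal (\<sigma> (Suc m) + min H (U (Suc (Suc m)) \<omega>))"
      using H U[of "Suc (Suc m)"] by simp
    also have "\<dots> \<le> T_HH U D d \<omega>"
      unfolding T_HH_def
    proof (rule INF_greatest, rule ccontr)
      fix t assume t: "t \<in> {t. 0 \<le> t \<and> downtime U D t \<omega> = t - d}"
        and "\<not> ereal (\<sigma> (Suc m) + min H (U (Suc (Suc m)) \<omega>)) \<le> ereal t"
      then have t': "t < \<sigma> (Suc m) + H" "t < \<sigma> (Suc (Suc m))" by (auto simp: \<sigma>_Suc)
      then obtain k where k: "k < Suc (Suc m)" "\<sigma> k \<le> t" "t < \<sigma> (Suc k)"
        using bracketing_index[of \<sigma> t "Suc (Suc m)"] t \<sigma>0 by auto
      have "x k = t - \<sigma> k" using t down[OF k(2,3)] by simp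
      moreover have "t - \<sigma> k < x k"
        using k t' xm U_less[of k] n by (cases "k = Suc m") (auto simp: \<sigma>_Suc)
      ultimately show False by simp
    qed
    finally show "B < T_HH U D d \<omega>" .
  }
qed

lemma exits_Suc:
  assumes "exits H z x (Suc n)"
  shows "z + x 0 < H" "0 \<le> x 0" "exits H (H - (z + x 0)) (\<lambda>k. x (Suc k)) n"
proof -
  have 0: "0 \<le> z" "z + x 0 < H" "0 \<le> x 0"
    using exits_before[OF assms, of 0] by auto
  then show "z + x 0 < H" "0 \<le> x 0" by auto
  show "exits H (H - (z + x 0)) (\<lambda>k. x (Suc k)) n"
    using assms unfolding exits_def walk_shift[of z x H n, OF 0(1,3,2)] .
qed

section \<open>From the parity of the exit to the hitting probabilities\<close>

text \<open>Here \<open>T\<close> belongs to the opposite side and \<open>S\<close> to the starting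
  side. As the order is almost surely strict, ties are null, and the two events agree up to null
  sets with the even exits and their complement.\<close>

lemma (in prob_space) first_hit_probabilities:
  fixes X :: "nat \<Rightarrow> 'a \<Rightarrow> real" and S T :: "'a \<Rightarrow> ereal" and a b H :: real
  assumes ind: "indep_vars (\<lambda>_. borel) X UNIV"
    and X: "\<And>n. distributed M lborel (X n) (exponential_density (if even n then a else b))"
    and pos: "0 < a" "0 < b" "0 < H" "a \<noteq> b"
    and ST [measurable]: "S \<in> borel_measurable M" "T \<in> borel_measurable M"
    and order: "AE \<omega> in M. \<forall>n. exits H 0 (\<lambda>k. X k \<omega>) n \<longrightarrow> (if even n then T \<omega> < S \<omega> else S \<omega> < T \<omega>)"
  shows "prob {\<omega> \<in> space M. min (S \<omega>) (T \<omega>) = T \<omega>} = (b - a) / (b - a * exp ((a - b) * H))"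
    and "prob {\<omega> \<in> space M. min (S \<omega>) (T \<omega>) = S \<omega>} = 1 - (b - a) / (b - a * exp ((a - b) * H))"
proof -
  let ?even = "{\<omega> \<in> space M. \<exists>n. even n \<and> exits H 0 (\<lambda>k. X k \<omega>) n}"
  note exit = exit_even_probability[OF ind X pos] exit_AE[OF ind X pos]
  note exits_measurable[OF ind X pos, measurable]
  have "?even \<in> events" by measurable
  have order': "AE \<omega> in M. (\<omega> \<in> ?even \<longrightarrow> T \<omega> < S \<omega>) \<and> (\<omega> \<in> space M - ?even \<longrightarrow> S \<omega> < T \<omega>)"
    using order exit(2) by eventually_elim (auto split: if_splits)
  have "prob {\<omega> \<in> space M. min (S \<omega>) (T \<omega>) = T \<omega>} = prob ?even"
  proof (rule finite_measure_eq_AE)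
    show "AE \<omega> in M. \<omega> \<in> {\<omega> \<in> space M. min (S \<omega>) (T \<omega>) = T \<omega>} \<longleftrightarrow> \<omega> \<in> ?even"
      using order' AE_space by eventually_elim (auto simp: min_def split: if_splits)
  qed measurable
  then show "prob {\<omega> \<in> space M. min (S \<omega>) (T \<omega>) = T \<omega>} = (b - a) / (b - a * exp ((a - b) * H))"
    using exit(1) by simp
  have "prob {\<omega> \<in> space M. min (S \<omega>) (T \<omega>) = S \<omega>} = prob (space M - ?even)"
  proof (rule finite_measure_eq_AE)
    show "AE \<omega> in M. \<omega> \<in> {\<omega> \<in> space M. min (S \<omega>) (T \<omega>) = S \<omega>} \<longleftrightarrow> \<omega> \<in> space M - ?even"
      using order' AE_space by eventually_elim (auto simp: min_def split: if_splits)
  qed measurable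
  then show "prob {\<omega> \<in> space M. min (S \<omega>) (T \<omega>) = S \<omega>} = 1 - (b - a) / (b - a * exp ((a - b) * H))"
    using exit(1) prob_compl[OF \<open>?even \<in> events\<close>] by simp
qed

text \<open>The numbers \<open>b\<close> and \<open>a * exp ((a - b) * H)\<close> lie strictly on
  opposite sides of \<open>a\<close>.\<close>

lemma exp_denominator_nonzero:
  fixes a b H :: real
  assumes "0 < a" "0 < H" "a \<noteq> b"
  shows "b - a * exp ((a - b) * H) \<noteq> 0"
proof (cases "a < b")
  case True
  then have "exp ((a - b) * H) < 1" using assms by (simp add: mult_neg_pos)
  then have "a * exp ((a - b) * H) < a * 1" using assms by (intro mult_strict_left_mono)
  then show ?thesis using True by simp
next
  case False
  then have "1 < exp ((a - b) * H)" using assms by simp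
  then have "a * 1 < a * exp ((a - b) * H)" using assms by (intro mult_strict_left_mono)
  then show ?thesis using False by simp
qed

lemma (in prob_space) AE_exponential_pos:
  assumes X: "distributed M lborel X (exponential_density l)" and l: "0 < l"
  shows "AE \<omega> in M. 0 < X \<omega>"
proof -
  have "AE x in lborel. x \<noteq> (0::real)" by (rule AE_lborel_singleton)
  then show ?thesis
    using distributed_AE2[OF X, of "\<lambda>x. 0 < x"] l
    by (auto simp: exponential_density_def elim!: eventually_mono)
qed

text \<open>A nonnegative down time forces \<open>t \<ge> H\<close> at a solution. Thus the start at
  \<open>0\<close> becomes the case \<open>d = H\<close> of \<open>hitting_order\<close>.\<close>

lemma T_0H_eq_T_HH:
  assumes "\<And>i. i \<ge> 1 \<Longrightarrow> 0 \<le> D i \<omega>" "0 \<le> H"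
  shows "T_0H H U D \<omega> = T_HH U D H \<omega>"
proof -
  have "0 \<le> downtime U D t \<omega>" for t
    unfolding downtime_def using assms by (intro sum_nonneg) auto
  then have "H \<le> t \<and> downtime U D t \<omega> = t - H \<longleftrightarrow> 0 \<le> t \<and> downtime U D t \<omega> = t - H" for t
    using assms(2) by (smt (verit))
  then show ?thesis by (simp add: T_0H_def T_HH_def)
qed

lemma hitting_order_from_0:
  assumes UD: "\<And>i. i \<ge> 1 \<Longrightarrow> 0 < U i \<omega>" "\<And>i. i \<ge> 1 \<Longrightarrow> 0 < D i \<omega>" and H: "0 < H"
    and ex: "exits H 0 (\<lambda>k. alternate U D k \<omega>) n"
  shows "if even n then T_0H H U D \<omega> < T_00 U D \<omega> else T_00 U D \<omega> < T_0H H U D \<omega>"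
proof -
  have "T_0H H U D \<omega> = T_HH U D H \<omega>"
    using UD H by (intro T_0H_eq_T_HH) (auto intro: less_imp_le)
  then show ?thesis
    using hitting_order[of U \<omega> H H "\<lambda>t. 0 < t" D n] UD(1) H ex by (simp add: T_00_def)
qed

text \<open>The initial descent is move \<open>0\<close> of the reflected walk, which shifts the
  parity in \<open>hitting_order\<close> by one. If the descent alone exceeds \<open>H\<close>, the
  exit is at \<open>0\<close>, and \<open>T_H0\<close> precedes any hit of \<open>H\<close>, since
  the down time is zero until the first jump.\<close>

lemma hitting_order_from_H:
  assumes U: "\<And>i. i \<ge> 1 \<Longrightarrow> 0 < U i \<omega>" and H: "0 < H"
    and ex: "exits H 0 (case_nat d (\<lambda>k. alternate U D k \<omega>)) n"
  shows "if even n then T_H0 H U D d \<omega> < T_HH U D d \<omega> else T_HH U D d \<omega> < T_H0 H U D d \<omega>"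
proof (cases n)
  case 0
  then have d: "H < d" using ex by (simp add: exits_def)
  have down: "downtime U D t \<omega> = 0" if "0 \<le> t" "t < U 1 \<omega>" for t
    using upcount_eqI[of U \<omega> 0 t] U that by (simp add: downtime_def)
  have "T_H0 H U D d \<omega> \<le> ereal 0"
    unfolding T_H0_def using down[of 0] U[of 1] d by (intro Inf_lower) auto
  also have "\<dots> < ereal (min H (U 1 \<omega>))"
    using H U[of 1] by simp
  also have "\<dots> \<le> T_HH U D d \<omega>"
    unfolding T_HH_def
  proof (rule INF_greatest)
    fix t assume "t \<in> {t. 0 \<le> t \<and> downtime U D t \<omega> = t - d}"
    then have "\<not> (t < H \<and> t < U 1 \<omega>)" using down[of t] d by auto
    then show "ereal (min H (U 1 \<omega>)) \<le> ereal t" by (simp add: min_le_iff_disj not_less[symmetric])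
  qed
  finally show ?thesis using 0 by simp
next
  case (Suc m)
  have d: "d < H" "0 \<le> d" and ex': "exits H (H - d) (\<lambda>k. alternate U D k \<omega>) m"
    using exits_Suc[OF ex[unfolded Suc]] by auto
  then show ?thesis
    using hitting_order[of U \<omega> H d "\<lambda>t. 0 \<le> t" D m] U H Suc by (simp add: T_H0_def)
qed

theorem theorem4p1:
  fixes M :: "'a measure"
    and U D :: "nat \<Rightarrow> 'a \<Rightarrow> real"
    and D0 :: "'a \<Rightarrow> real"
    and lam mu H :: real
  assumes "prob_space M"
    and "lam > 0" and "mu > 0" and "H > 0" and "lam \<noteq> mu"
    and "\<And>n. n \<ge> 1 \<Longrightarrow> distributed M lborel (U n) (exponential_density lam)"
    and "\<And>n. n \<ge> 1 \<Longrightarrow> distributed M lborel (D n) (exponential_density mu)"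
    and "distributed M lborel D0 (exponential_density mu)"
    and "prob_space.indep_vars M (\<lambda>_. borel)
           (case_sum U (case_sum D (\<lambda>_::unit. D0))) ({1..} <+> ({1..} <+> UNIV))"
  shows "P_0H M H U D = (mu - lam) / (mu - lam * exp ((lam - mu) * H)) \<and>
         P_H0 M H U D D0 = (lam - mu) / (lam - mu * exp ((mu - lam) * H)) \<and>
         P_00 M H U D = 1 - P_0H M H U D \<and>
         P_00 M H U D
           = (lam * exp (H * (lam - mu)) - lam) / (lam * exp (H * (lam - mu)) - mu) \<and>
         P_HH M H U D D0 = 1 - P_H0 M H U D D0 \<and>
         P_HH M H U D D0
           = mu * (1 - exp (- (lam - mu) * H)) / (lam - mu * exp (- (lam - mu) * H))"
proof -
  interpret prob_space M by fact
  note pos = \<open>lam > 0\<close> \<open>mu > 0\<close> \<open>H > 0\<close>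
  note U = assms(6) and D = assms(7) and D0 = assms(8) and ind = assms(9)
  let ?V = "case_sum U (case_sum D (\<lambda>_::unit. D0))"
  \<comment> \<open>Indices of the alternating moves within the jointly independent family;
    \<open>j\<close> puts the initial descent \<open>D0\<close> in front.\<close>
  define i :: "nat \<Rightarrow> nat + nat + unit" where
    "i n = (if even n then Inl (Suc (n div 2)) else Inr (Inl (Suc (n div 2))))" for n
  define j where "j = case_nat (Inr (Inr ())) i"
  let ?X = "\<lambda>n. case n of 0 \<Rightarrow> D0 | Suc k \<Rightarrow> alternate U D k"
  have inj_i: "inj i"
  proof (rule injI)
    fix m n assume "i m = i n"
    then have "even m = even n" "m div 2 = n div 2" by (auto simp: i_def split: if_splits)
    then show "m = n" by presburger
  qed
  have i_neq: "i n \<noteq> Inr (Inr x)" for n x by (simp add: i_def)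
  have "inj j"
  proof (rule injI)
    fix m n assume "j m = j n"
    then show "m = n"
      using i_neq i_neq[symmetric] by (cases m; cases n) (auto simp: j_def dest: injD[OF inj_i])
  qed
  moreover have "indep_vars (\<lambda>_. borel) ?V (range j)"
    using ind by (rule indep_vars_subset) (auto simp: i_def j_def split: nat.splits)
  ultimately have "indep_vars (\<lambda>_. borel) (\<lambda>n. ?V (j n)) UNIV"
    using indep_vars_reindex by blast
  moreover have "(\<lambda>n. ?V (j n)) = ?X"
    by (auto simp: fun_eq_iff i_def j_def alternate_def split: nat.splits)
  ultimately have ind_H: "indep_vars (\<lambda>_. borel) ?X UNIV" by simp
  have "indep_vars (\<lambda>_. borel) ?V (range i)"
    using ind by (rule indep_vars_subset) (auto simp: i_def)
  then have "indep_vars (\<lambda>_. borel) (\<lambda>n. ?V (i n)) UNIV"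
    using inj_i indep_vars_reindex by blast
  moreover have "(\<lambda>n. ?V (i n)) = alternate U D"
    by (auto simp: fun_eq_iff i_def alternate_def)
  ultimately have ind_0: "indep_vars (\<lambda>_. borel) (alternate U D) UNIV" by simp
  have dist_0: "distributed M lborel (alternate U D n) (exponential_density (if even n then lam else mu))" for n
    using U D by (auto simp: alternate_def)
  have dist_H: "distributed M lborel (?X n) (exponential_density (if even n then mu else lam))" for n
    using D0 dist_0[of "n - 1"] by (cases n) auto
  have UD_meas: "\<And>n. n \<ge> 1 \<Longrightarrow> U n \<in> borel_measurable M" "\<And>n. n \<ge> 1 \<Longrightarrow> D n \<in> borel_measurable M"
    "D0 \<in> borel_measurable M"
    using distributed_measurable[OF U] distributed_measurable[OF D] distributed_measurable[OF D0] by auto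
  have T_meas: "T_00 U D \<in> borel_measurable M" "T_0H H U D \<in> borel_measurable M"
    "(\<lambda>\<omega>. T_HH U D (D0 \<omega>) \<omega>) \<in> borel_measurable M" "(\<lambda>\<omega>. T_H0 H U D (D0 \<omega>) \<omega>) \<in> borel_measurable M"
    using borel_measurable_hitting_ge[OF UD_meas(1,2), where d = "\<lambda>_. H" and P = "\<lambda>t. 0 < t" and H = H]
      borel_measurable_hitting_eq[OF UD_meas(1,2), where d = "\<lambda>_. H" and c = H]
      borel_measurable_hitting_eq[OF UD_meas(1,2), where d = D0 and c = 0]
      borel_measurable_hitting_ge[OF UD_meas(1,2), where d = D0 and P = "\<lambda>t. 0 \<le> t" and H = H]
      UD_meas(3)
    by (simp_all add: T_00_def[abs_def] T_0H_def[abs_def] T_HH_def[abs_def] T_H0_def[abs_def])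
  have positive: "AE \<omega> in M. \<forall>i\<ge>1. 0 < U i \<omega> \<and> 0 < D i \<omega>"
    unfolding AE_all_countable
  proof
    fix i show "AE \<omega> in M. 1 \<le> i \<longrightarrow> 0 < U i \<omega> \<and> 0 < D i \<omega>"
      using AE_exponential_pos[OF U pos(1), of i] AE_exponential_pos[OF D pos(2), of i]
      by (cases "1 \<le> i") auto
  qed
  have order_0: "AE \<omega> in M. \<forall>n. exits H 0 (\<lambda>k. alternate U D k \<omega>) n \<longrightarrow>
      (if even n then T_0H H U D \<omega> < T_00 U D \<omega> else T_00 U D \<omega> < T_0H H U D \<omega>)"
    using positive by eventually_elim (intro allI impI hitting_order_from_0 pos; simp)
  have X_apply: "(\<lambda>k. ?X k \<omega>) = case_nat (D0 \<omega>) (\<lambda>k. alternate U D k \<omega>)" for \<omega>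
    by (auto simp: fun_eq_iff split: nat.splits)
  have order_H: "AE \<omega> in M. \<forall>n. exits H 0 (\<lambda>k. ?X k \<omega>) n \<longrightarrow>
      (if even n then T_H0 H U D (D0 \<omega>) \<omega> < T_HH U D (D0 \<omega>) \<omega>
       else T_HH U D (D0 \<omega>) \<omega> < T_H0 H U D (D0 \<omega>) \<omega>)"
    unfolding X_apply using positive
    by eventually_elim (intro allI impI hitting_order_from_H pos; simp)
  \<comment> \<open>A particle that rises first has rates \<open>lam\<close>, \<open>mu\<close> in
    turn; starting at \<open>H\<close> exchanges them.\<close>
  note P_0 = first_hit_probabilities[OF ind_0 dist_0 pos \<open>lam \<noteq> mu\<close> T_meas(1,2) order_0]
  note P_H = first_hit_probabilities[OF ind_H dist_H pos(2,1,3) \<open>lam \<noteq> mu\<close>[symmetric] T_meas(3,4) order_H]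
  have "1 - (mu - lam) / (mu - lam * exp ((lam - mu) * H))
      = (lam * exp (H * (lam - mu)) - lam) / (lam * exp (H * (lam - mu)) - mu)"
  proof -
    have "1 - (mu - lam) / (mu - lam * exp ((lam - mu) * H))
        = (lam - lam * exp (H * (lam - mu))) / (mu - lam * exp (H * (lam - mu)))"
      using exp_denominator_nonzero[OF pos(1,3) \<open>lam \<noteq> mu\<close>]
      by (simp add: diff_divide_eq_iff mult.commute[of H] diff_divide_distrib[symmetric])
    also have "\<dots> = (lam * exp (H * (lam - mu)) - lam) / (lam * exp (H * (lam - mu)) - mu)"
      by (metis minus_diff_eq minus_divide_divide)
    finally show ?thesis .
  qed
  moreover have "1 - (lam - mu) / (lam - mu * exp ((mu - lam) * H))
      = mu * (1 - exp (- (lam - mu) * H)) / (lam - mu * exp (- (lam - mu) * H))"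
    using exp_denominator_nonzero[OF pos(2,3) \<open>lam \<noteq> mu\<close>[symmetric]]
    by (simp add: diff_divide_eq_iff right_diff_distrib)
  ultimately show ?thesis
    using P_0 P_H
    unfolding P_00_def P_0H_def P_HH_def P_H0_def T_0_star_def T_H_star_def by simp
qed

end
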